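(* For any integer $n\ge 2$ there is an angle $\theta\in(0,\pi)$ such that all (nondegenerate) bounded orbits of the no-slip billiard in the open wedge of angle $\theta$ have period $2n$.
   Context: No-slip wedge billiard of angle $\theta\in(0,\pi)$: a disk of radius $R>0$ with uniform mass distribution moves in an infinite wedge; taking the boundary adjusted by the distance $R$, its center moves in $W_\theta=\{(x_1,x_2): |x_1|\le x_2\tan(\theta/2)\}$, whose vertex is the origin and whose outward bisector is the positive $x_2$-axis. The rotational coordinate is $x_0=\frac{R}{\sqrt2}\vartheta$, where $\vartheta$ is the angle of rotation of the disk (measured clockwise, when $x_1$ points right and $x_2$ points up). The velocity is $v=(\dot x_0,\dot x_1,\dot x_2)$, constant between collisions; a collision occurs when the center reaches $\partial W_\theta$. No-slip collision: at a boundary point with unit normal $\nu\in\mathbb{R}^2$ pointing into $W_\theta$, let $\tau$ be $\nu$ rotated by $-\pi/2$ (so $\tau=(1,0)$ if $\nu=(0,1)$). Writing $v_0^\pm$ for the rotational component $\dot x_0$ and $w^\pm\in\mathbb{R}^2$ for the planar velocity $(\dot x_1,\dot x_2)$ before $(-)$ and after $(+)$ the collision, $$v_0^+=-\tfrac13 v_0^-+\tfrac{2\sqrt2}{3}\,w^-\cdot\tau,\qquad w^+=\left[\tfrac{2\sqrt2}{3}v_0^-+\tfrac13\,w^-\cdot\tau\right]\tau-(w^-\cdot\nu)\,\nu .$$ An orbit is recorded as the sequence of states at collisions, a state being the position of the center on $\partial W_\theta$ (other than the vertex) together with the post-collision velocity $v\in\mathbb{R}^3$, whose planar part points strictly into $W_\theta$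 (the angle of rotation itself is disregarded). An orbit is periodic if its state recurs, and its period is the least number $p\ge1$ of collisions after which the state recurs. An orbit is bounded if it never escapes to infinity: it has infinitely many collisions in forward time and the center stays in a bounded set. For given $n$ and the corresponding $\theta$, "degenerate" refers to exceptional bounded orbits that are periodic with period less than $2n$; a bounded orbit is nondegenerate if it is not of this kind. *)

theory Defs
  imports "HOL-Analysis.Analysis"
begin

type_synonym plane = "real \<times> real"

text \<open>A velocity is a pair \<open>(v0, w)\<close>: \<open>v0\<close> is the speed in the rescaled rotational coordinate
  \<open>x0 = R/sqrt 2 * (angle of rotation)\<close>, and \<open>w\<close> is the planar velocity of the center.
  In these coordinates the dynamics does not depend on the radius \<open>R > 0\<close>.
  A state is a position of the center on the boundary together with a post-collision velocity.\<close>

type_synonym velocity = "real \<times> plane"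
type_synonym state = "plane \<times> velocity"

definition wedge :: "real \<Rightarrow> plane set" where
  "wedge \<theta> = {(x1, x2). \<bar>x1\<bar> \<le> x2 * tan (\<theta> / 2)}"

text \<open>Only meaningful at points \<open>q\<close> of the frontier of the wedge other than the vertex; the two
  sides are told apart by the sign of the first coordinate.\<close>

definition inward_normal :: "real \<Rightarrow> plane \<Rightarrow> plane" where
  "inward_normal \<theta> q = (- sgn (fst q) * cos (\<theta> / 2), sin (\<theta> / 2))"

text \<open>Rotation by \<open>- pi / 2\<close>.\<close>

definition rot_cw :: "plane \<Rightarrow> plane" where
  "rot_cw \<nu> = (snd \<nu>, - fst \<nu>)"

definition noslip_reflect :: "plane \<Rightarrow> velocity \<Rightarrow> velocity" where
  "noslip_reflect \<nu> v =
     (let v0 = fst v; w = snd v; \<tau> = rot_cw \<nu> in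
       (- (1/3) * v0 + (2 * sqrt 2 / 3) * (w \<bullet> \<tau>),
        ((2 * sqrt 2 / 3) * v0 + (1/3) * (w \<bullet> \<tau>)) *\<^sub>R \<tau> - (w \<bullet> \<nu>) *\<^sub>R \<nu>))"

definition is_state :: "real \<Rightarrow> state \<Rightarrow> bool" where
  "is_state \<theta> s \<longleftrightarrow>
     fst s \<in> frontier (wedge \<theta>) \<and> fst s \<noteq> 0 \<and>
     snd (snd s) \<bullet> inward_normal \<theta> (fst s) > 0"

text \<open>Free flight from \<open>s\<close> up to the first return to the boundary, followed by the collision there.
  A flight that never returns to the boundary, or returns at the vertex, has no successor.\<close>

definition next_collision :: "real \<Rightarrow> state \<Rightarrow> state \<Rightarrow> bool" where
  "next_collision \<theta> s s' \<longleftrightarrow>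
     is_state \<theta> s \<and> is_state \<theta> s' \<and>
     (\<exists>t>0. fst s' = fst s + t *\<^sub>R snd (snd s) \<and>
        (\<forall>r. 0 < r \<and> r < t \<longrightarrow> fst s + r *\<^sub>R snd (snd s) \<notin> frontier (wedge \<theta>)) \<and>
        snd s' = noslip_reflect (inward_normal \<theta> (fst s')) (snd s))"

definition infinite_orbit :: "real \<Rightarrow> (nat \<Rightarrow> state) \<Rightarrow> bool" where
  "infinite_orbit \<theta> s \<longleftrightarrow> (\<forall>k. next_collision \<theta> (s k) (s (Suc k)))"

definition bounded_orbit :: "real \<Rightarrow> (nat \<Rightarrow> state) \<Rightarrow> bool" where
  "bounded_orbit \<theta> s \<longleftrightarrow> infinite_orbit \<theta> s \<and>
     bounded (\<Union>k. closed_segment (fst (s k)) (fst (s (Suc k))))"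

definition recurs_after :: "nat \<Rightarrow> (nat \<Rightarrow> state) \<Rightarrow> bool" where
  "recurs_after p s \<longleftrightarrow> (\<forall>k. s (k + p) = s k)"

definition periodic_orbit :: "(nat \<Rightarrow> state) \<Rightarrow> bool" where
  "periodic_orbit s \<longleftrightarrow> (\<exists>p\<ge>1. recurs_after p s)"

text \<open>Meaningful for periodic orbits only.\<close>

definition orbit_period :: "(nat \<Rightarrow> state) \<Rightarrow> nat" where
  "orbit_period s = (LEAST p. p \<ge> 1 \<and> recurs_after p s)"

definition nondegenerate_bounded_orbit :: "nat \<Rightarrow> real \<Rightarrow> (nat \<Rightarrow> state) \<Rightarrow> bool" where
  "nondegenerate_bounded_orbit n \<theta> s \<longleftrightarrow>
     bounded_orbit \<theta> s \<and> \<not> (periodic_orbit s \<and> orbit_period s < 2 * n)"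

end

theory Submission
  imports Defs
begin

text \<open>
  The collision map at a side with tangent \<open>\<tau>\<close> is the rotation by \<open>pi\<close> of velocity space about
  the axis \<open>(1, sqrt 2 \<tau>)\<close>. Both axes are orthogonal to \<open>N = (sqrt 2 sin \<alpha>, -1, 0)\<close>, where
  \<open>\<alpha> = \<theta> / 2\<close>, and enclose an angle \<open>\<phi>\<close> with \<open>sin (\<phi> / 2) = sqrt (2/3) cos \<alpha>\<close>. Flights alternate
  between the two sides, so two consecutive collisions rotate the velocity about \<open>N\<close> by \<open>2 \<phi>\<close>.
  The product of the distance to the vertex and the outgoing normal speed is the same at all
  collisions. Hence if \<open>\<phi> = pi / n\<close>, every infinite orbit recurs after \<open>2 n\<close> collisions. The velocity
  \<open>N\<close> gives an orbit of period 2, and small perturbations of it orthogonal to \<open>N\<close> have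
  minimal period \<open>2 n\<close>.
\<close>

section \<open>Wedge parameters and velocity coordinates adapted to the common normal
  \<open>N\<close>\<close>

locale noslip_wedge =
  fixes \<alpha> \<phi> :: real
  assumes \<alpha>_pos: "0 < \<alpha>" and \<alpha>_less: "\<alpha> < pi / 2"
    and \<phi>_pos: "0 < \<phi>" and \<phi>_less: "\<phi> < pi"
    and cos_\<alpha>: "cos \<alpha> = sqrt (3/2) * sin (\<phi> / 2)"
begin

text \<open>The sign \<open>\<sigma>\<close> is 1 on the right side and -1 on the left;
  \<open>r\<close> is the distance to the vertex.\<close>

definition bdry :: "real \<Rightarrow> real \<Rightarrow> plane" where
  "bdry \<sigma> r = (\<sigma> * r * sin \<alpha>, r * cos \<alpha>)"

definition side_normal :: "real \<Rightarrow> plane" where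
  "side_normal \<sigma> = (- \<sigma> * cos \<alpha>, sin \<alpha>)"

text \<open>The length of \<open>N = (sqrt 2 * sin \<alpha>, -1, 0)\<close>.\<close>

definition axis_norm :: real where
  "axis_norm = sqrt (1 + 2 * (sin \<alpha>)\<^sup>2)"

definition axial :: "velocity \<Rightarrow> real" where
  "axial v = (sqrt 2 * sin \<alpha> * fst v - fst (snd v)) / axis_norm"

text \<open>The component orthogonal to \<open>N\<close>, in the orthonormal basis
  \<open>(1, sqrt 2 * sin \<alpha>, 0) / axis_norm\<close>, \<open>(0, 0, 1)\<close>. Complex
  notation turns rotations about \<open>N\<close> into multiplications by
  \<open>cis\<close>.\<close>

definition transverse :: "velocity \<Rightarrow> complex" where
  "transverse v = Complex ((fst v + sqrt 2 * sin \<alpha> * fst (snd v)) / axis_norm) (snd (snd v))"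

definition vel :: "real \<Rightarrow> complex \<Rightarrow> velocity" where
  "vel A z = ((sqrt 2 * sin \<alpha> * A + Re z) / axis_norm,
     ((sqrt 2 * sin \<alpha> * Re z - A) / axis_norm, Im z))"

lemma sin_pos: "sin \<alpha> > 0"
  using \<alpha>_pos \<alpha>_less by (intro sin_gt_zero) auto

lemma cos_pos: "cos \<alpha> > 0"
  using \<alpha>_pos \<alpha>_less by (intro cos_gt_zero) auto

lemma axis_norm_pos: "axis_norm > 0"
  unfolding axis_norm_def by (simp add: add_pos_nonneg)

lemma axis_norm_sq: "axis_norm\<^sup>2 = 1 + 2 * (sin \<alpha>)\<^sup>2"
  unfolding axis_norm_def by simp

text \<open>The collision axis \<open>(1, sqrt 2 \<tau>)\<close> has length \<open>sqrt 3\<close>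
  and transverse part \<open>Complex axis_norm (\<sigma> * sqrt 2 * cos \<alpha>)\<close>, so it
  makes the angle \<open>\<sigma> * \<phi> / 2\<close> with the real axis.\<close>

lemma axis_norm_eq: "axis_norm = sqrt 3 * cos (\<phi> / 2)"
proof -
  have "(sin \<alpha>)\<^sup>2 = 1 - 3/2 * (sin (\<phi> / 2))\<^sup>2"
    by (simp add: sin_squared_eq[of \<alpha>] cos_\<alpha> power_mult_distrib)
  then have "axis_norm\<^sup>2 = 3 * (cos (\<phi> / 2))\<^sup>2"
    by (simp add: axis_norm_sq cos_squared_eq)
  also have "\<dots> = (sqrt 3 * cos (\<phi> / 2))\<^sup>2"
    by (simp add: power_mult_distrib)
  finally show ?thesis
    using axis_norm_pos \<phi>_pos \<phi>_less cos_gt_zero[of "\<phi> / 2"]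
    by (simp add: power2_eq_iff_nonneg)
qed

lemma cos_\<phi>: "cos \<phi> = 1 - 4/3 * (cos \<alpha>)\<^sup>2"
  using cos_double_sin[of "\<phi> / 2"] by (simp add: cos_\<alpha> power_mult_distrib)

lemma sin_\<phi>: "sin \<phi> = 2 * sqrt 2 / 3 * cos \<alpha> * axis_norm"
proof -
  have "sqrt 2 * sqrt (3/2) * sqrt 3 = (3::real)"
    by (simp add: real_sqrt_mult[symmetric])
  then have "2 * sqrt 2 / 3 * cos \<alpha> * axis_norm = 2 * sin (\<phi> / 2) * cos (\<phi> / 2)"
    by (simp add: cos_\<alpha> axis_norm_eq algebra_simps)
  then show ?thesis
    using sin_double[of "\<phi> / 2"] by simp
qed

lemma axis_norm_mult: "axis_norm * axis_norm = 1 + 2 * (sin \<alpha> * sin \<alpha>)"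
  using axis_norm_sq by (simp add: power2_eq_square)

lemma axis_norm_cancel: "x * (1 + 2 * (sin \<alpha> * sin \<alpha>)) / (axis_norm * axis_norm) = x"
  using axis_norm_pos by (simp add: axis_norm_mult[symmetric])

lemma axial_vel [simp]: "axial (vel A z) = A"
proof -
  have "axial (vel A z) = A * (1 + 2 * (sin \<alpha> * sin \<alpha>)) / (axis_norm * axis_norm)"
    by (simp add: axial_def vel_def add_divide_distrib diff_divide_distrib algebra_simps)
  then show ?thesis by (simp only: axis_norm_cancel)
qed

lemma transverse_vel [simp]: "transverse (vel A z) = z"
proof -
  have "Re (transverse (vel A z)) = Re z * (1 + 2 * (sin \<alpha> * sin \<alpha>)) / (axis_norm * axis_norm)"
    by (simp add: transverse_def vel_def add_divide_distrib diff_divide_distrib algebra_simps)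
  then show ?thesis
    by (simp only: axis_norm_cancel complex_eq_iff) (simp add: transverse_def vel_def)
qed

lemma vel_axial_transverse [simp]: "vel (axial v) (transverse v) = v"
proof -
  obtain u w1 w2 where v: "v = (u, w1, w2)" by (cases v) auto
  have "fst (vel (axial v) (transverse v))
      = u * (1 + 2 * (sin \<alpha> * sin \<alpha>)) / (axis_norm * axis_norm)"
    "fst (snd (vel (axial v) (transverse v)))
      = w1 * (1 + 2 * (sin \<alpha> * sin \<alpha>)) / (axis_norm * axis_norm)"
    by (simp_all add: axial_def transverse_def vel_def v add_divide_distrib diff_divide_distrib
        algebra_simps)
  then show ?thesis
    by (simp only: axis_norm_cancel prod_eq_iff) (simp add: transverse_def vel_def v)
qed

lemma velocity_eqI: "axial v = axial v' \<Longrightarrow> transverse v = transverse v' \<Longrightarrow> v = v'"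
  by (metis vel_axial_transverse)

section \<open>Collisions in the adapted coordinates\<close>

text \<open>Here \<open>p\<close> and \<open>q\<close> are the tangential and normal components of
  the planar velocity at side \<open>\<sigma>\<close>. A collision mixes the spin \<open>u\<close>
  with \<open>p\<close> only and reverses \<open>q\<close>.\<close>

lemma velocity_side_coordinatesE:
  assumes "\<sigma> = 1 \<or> \<sigma> = -1"
  obtains u p q where
    "v = (u, p * sin \<alpha> - \<sigma> * q * cos \<alpha>, \<sigma> * p * cos \<alpha> + q * sin \<alpha>)"
    "noslip_reflect (side_normal \<sigma>) v =
      (let u' = - u / 3 + 2 * sqrt 2 / 3 * p; p' = 2 * sqrt 2 / 3 * u + p / 3
       in (u', p' * sin \<alpha> + \<sigma> * q * cos \<alpha>, \<sigma> * p' * cos \<alpha> - q * sin \<alpha>))"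
    "snd v \<bullet> side_normal \<sigma> = q"
proof -
  obtain u w1 w2 where v: "v = (u, w1, w2)" by (cases v) auto
  define p where "p = w1 * sin \<alpha> + \<sigma> * w2 * cos \<alpha>"
  define q where "q = - \<sigma> * w1 * cos \<alpha> + w2 * sin \<alpha>"
  have \<sigma>2: "\<sigma> * (\<sigma> * x) = x" for x
    using assms by auto
  have "p * sin \<alpha> - \<sigma> * q * cos \<alpha> = w1 * (cos \<alpha> * cos \<alpha>) + w1 * (sin \<alpha> * sin \<alpha>)"
    "\<sigma> * p * cos \<alpha> + q * sin \<alpha> = w2 * (cos \<alpha> * cos \<alpha>) + w2 * (sin \<alpha> * sin \<alpha>)"
    unfolding p_def q_def by (simp_all add: algebra_simps \<sigma>2)
  then have w: "p * sin \<alpha> - \<sigma> * q * cos \<alpha> = w1" "\<sigma> * p * cos \<alpha> + q * sin \<alpha> = w2"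
    by (simp_all add: distrib_left[symmetric])
  have \<tau>: "(w1, w2) \<bullet> rot_cw (side_normal \<sigma>) = p" and \<nu>: "(w1, w2) \<bullet> side_normal \<sigma> = q"
    by (simp_all add: rot_cw_def side_normal_def inner_prod_def p_def q_def)
  show ?thesis
  proof (rule that[of u p q])
    show "noslip_reflect (side_normal \<sigma>) v =
      (let u' = - u / 3 + 2 * sqrt 2 / 3 * p; p' = 2 * sqrt 2 / 3 * u + p / 3
       in (u', p' * sin \<alpha> + \<sigma> * q * cos \<alpha>, \<sigma> * p' * cos \<alpha> - q * sin \<alpha>))"
      unfolding noslip_reflect_def v Let_def fst_conv snd_conv \<tau> \<nu>
      by (simp add: rot_cw_def side_normal_def algebra_simps)
  qed (simp_all add: v w \<nu>)
qed

text \<open>A half turn reverses every vector orthogonal to its axis, and \<open>N\<close> is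
  orthogonal to both collision axes.\<close>

lemma axial_reflect:
  assumes "\<sigma> = 1 \<or> \<sigma> = -1"
  shows "axial (noslip_reflect (side_normal \<sigma>) v) = - axial v"
proof -
  obtain u p q where v: "v = (u, p * sin \<alpha> - \<sigma> * q * cos \<alpha>, \<sigma> * p * cos \<alpha> + q * sin \<alpha>)"
    and v': "noslip_reflect (side_normal \<sigma>) v =
      (let u' = - u / 3 + 2 * sqrt 2 / 3 * p; p' = 2 * sqrt 2 / 3 * u + p / 3
       in (u', p' * sin \<alpha> + \<sigma> * q * cos \<alpha>, \<sigma> * p' * cos \<alpha> - q * sin \<alpha>))"
    using velocity_side_coordinatesE[OF assms] by metis
  define S where "S = sqrt (2::real)"
  have S: "S * (S * x) = 2 * x" for x by (simp add: S_def)
  have "S * sin \<alpha> * (- u / 3 + 2 * S / 3 * p)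
      - ((2 * S / 3 * u + p / 3) * sin \<alpha> + \<sigma> * q * cos \<alpha>)
    = - (S * sin \<alpha> * u - (p * sin \<alpha> - \<sigma> * q * cos \<alpha>))"
    by (simp add: field_simps S)
  then show ?thesis
    unfolding axial_def v' unfolding v Let_def S_def fst_conv snd_conv
    by (metis minus_divide_left)
qed

text \<open>On the plane orthogonal to \<open>N\<close> the half turn acts as the reflection in its
  axis, the line at angle \<open>\<sigma> * \<phi> / 2\<close>; this gives conjugation followed by
  multiplication with \<open>cis\<close> of twice that angle.\<close>

lemma transverse_reflect:
  assumes "\<sigma> = 1 \<or> \<sigma> = -1"
  shows "transverse (noslip_reflect (side_normal \<sigma>) v) = cis (\<sigma> * \<phi>) * cnj (transverse v)"
proof -
  obtain u p q where v: "v = (u, p * sin \<alpha> - \<sigma> * q * cos \<alpha>, \<sigma> * p * cos \<alpha> + q * sin \<alpha>)"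
    and v': "noslip_reflect (side_normal \<sigma>) v =
      (let u' = - u / 3 + 2 * sqrt 2 / 3 * p; p' = 2 * sqrt 2 / 3 * u + p / 3
       in (u', p' * sin \<alpha> + \<sigma> * q * cos \<alpha>, \<sigma> * p' * cos \<alpha> - q * sin \<alpha>))"
    using velocity_side_coordinatesE[OF assms] by metis
  \<comment> \<open>Opaque names reduce the claim to polynomial identities, with the squares of
    \<open>S\<close>, \<open>a\<close>, \<open>D\<close> and \<open>\<sigma>\<close> eliminated by
    rewriting.\<close>
  define S where "S = sqrt (2::real)"
  define a where "a = sin \<alpha>"
  define c where "c = cos \<alpha>"
  define D where "D = axis_norm"
  have S: "S * S = 2" "S * (S * x) = 2 * x" for x
    by (simp_all add: S_def)
  have a: "a * a = 1 - c * c"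
    using sin_squared_eq[of \<alpha>] by (simp add: a_def c_def power2_eq_square)
  have a': "a * (a * x) = x - c * (c * x)" for x
    by (simp add: a mult.assoc[symmetric] left_diff_distrib)
  have D: "D * D = 3 - 2 * (c * c)" "D \<noteq> 0"
    using axis_norm_pos axis_norm_sq a by (auto simp: D_def a_def power2_eq_square)
  have \<sigma>: "\<sigma> * (\<sigma> * x) = x" for x
    using assms by auto
  define w1 where "w1 = p * a - \<sigma> * q * c"
  define w2 where "w2 = \<sigma> * p * c + q * a"
  define u' where "u' = - u / 3 + 2 * S / 3 * p"
  define w1' where "w1' = (2 * S / 3 * u + p / 3) * a + \<sigma> * q * c"
  define w2' where "w2' = \<sigma> * (2 * S / 3 * u + p / 3) * c - q * a"
  have cos: "cos \<phi> = 1 - 4/3 * (c * c)" and sin: "sin \<phi> = 2 * S / 3 * c * D"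
    by (simp_all add: cos_\<phi> sin_\<phi> c_def S_def D_def power2_eq_square)
  \<comment> \<open>The real part is compared after multiplication by \<open>D\<close>:
    \<open>sin \<phi>\<close> contributes another factor \<open>D\<close>, and \<open>D * D\<close>
    is polynomial in \<open>c\<close>.\<close>
  have "u' + S * a * w1'
      = (1 - 4/3 * (c * c)) * (u + S * a * w1) + \<sigma> * (2 * S / 3 * c * (3 - 2 * (c * c))) * w2"
    unfolding u'_def w1'_def w1_def w2_def by (simp add: field_simps S a a' \<sigma>)
  then have "u' + S * a * w1' = cos \<phi> * (u + S * a * w1) + \<sigma> * sin \<phi> * w2 * D"
    unfolding cos sin D(1)[symmetric] by (simp add: algebra_simps)
  then have 1: "(u' + S * a * w1') / D = cos \<phi> * ((u + S * a * w1) / D) + \<sigma> * sin \<phi> * w2"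
    using D(2) by (simp add: field_simps)
  have "w2' = \<sigma> * (2 * S / 3 * c) * (u + S * a * w1) - (1 - 4/3 * (c * c)) * w2"
    unfolding w2'_def w1_def w2_def by (simp add: field_simps S a a' \<sigma>)
  moreover have "\<sigma> * (2 * S / 3 * c * D) * (x / D) = \<sigma> * (2 * S / 3 * c) * x" for x
    using D(2) by simp
  ultimately have 2: "w2' = \<sigma> * sin \<phi> * ((u + S * a * w1) / D) - cos \<phi> * w2"
    unfolding cos sin by simp
  have t: "transverse v = Complex ((u + S * a * w1) / D) w2"
    "transverse (noslip_reflect (side_normal \<sigma>) v) = Complex ((u' + S * a * w1') / D) w2'"
    unfolding transverse_def v' unfolding v Let_def fst_conv snd_conv
    by (simp_all add: S_def a_def c_def D_def w1_def w2_def u'_def w1'_def w2'_def)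
  show ?thesis
    unfolding t 1 2 using assms by (auto simp: complex_eq_iff)
qed

lemma normal_reflect:
  assumes "\<sigma> = 1 \<or> \<sigma> = -1"
  shows "snd (noslip_reflect (side_normal \<sigma>) v) \<bullet> side_normal \<sigma> = - (snd v \<bullet> side_normal \<sigma>)"
proof -
  obtain u p q where v': "noslip_reflect (side_normal \<sigma>) v =
      (let u' = - u / 3 + 2 * sqrt 2 / 3 * p; p' = 2 * sqrt 2 / 3 * u + p / 3
       in (u', p' * sin \<alpha> + \<sigma> * q * cos \<alpha>, \<sigma> * p' * cos \<alpha> - q * sin \<alpha>))"
    and q: "snd v \<bullet> side_normal \<sigma> = q"
    using velocity_side_coordinatesE[OF assms] by metis
  have "(p' * sin \<alpha> + \<sigma> * q * cos \<alpha>, \<sigma> * p' * cos \<alpha> - q * sin \<alpha>) \<bullet> side_normal \<sigma>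
      = - (q * (cos \<alpha> * cos \<alpha>) + q * (sin \<alpha> * sin \<alpha>))" for p'
    using assms by (auto simp: side_normal_def inner_prod_def algebra_simps)
  then show ?thesis
    unfolding v' q by (simp add: Let_def distrib_left[symmetric])
qed

section \<open>Boundary of the wedge and its parametrization\<close>

lemma frontier_wedge: "frontier (wedge (2 * \<alpha>)) = {q. \<bar>fst q\<bar> = snd q * tan \<alpha>}"
proof -
  have T: "tan \<alpha> > 0"
    using \<alpha>_pos \<alpha>_less by (intro tan_gt_zero) auto
  have W: "wedge (2 * \<alpha>) = {q. \<bar>fst q\<bar> \<le> snd q * tan \<alpha>}"
    by (auto simp: wedge_def)
  have "closed (wedge (2 * \<alpha>))"
    unfolding W by (intro closed_Collect_le continuous_intros)
  moreover have "open {q :: plane. \<bar>fst q\<bar> < snd q * tan \<alpha>}"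
    by (intro open_Collect_less continuous_intros)
  then have "{q :: plane. \<bar>fst q\<bar> < snd q * tan \<alpha>} \<subseteq> interior (wedge (2 * \<alpha>))"
    by (intro interior_maximal) (auto simp: W)
  ultimately have "frontier (wedge (2 * \<alpha>)) \<subseteq> {q. \<bar>fst q\<bar> = snd q * tan \<alpha>}"
    by (force simp: frontier_def W)
  moreover have "q \<in> frontier (wedge (2 * \<alpha>))" if q: "\<bar>fst q\<bar> = snd q * tan \<alpha>" for q :: plane
    unfolding frontier_straddle
  proof (intro CollectI allI impI conjI)
    fix e :: real assume "e > 0"
    then show "\<exists>x\<in>wedge (2 * \<alpha>). dist q x < e"
      using q by (intro bexI[of _ q]) (auto simp: W)
    \<comment> \<open>Moving a boundary point straight down leaves the wedge, because
      \<open>tan \<alpha> > 0\<close>.\<close>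
    show "\<exists>x. x \<notin> wedge (2 * \<alpha>) \<and> dist q x < e"
      using q T \<open>e > 0\<close>
      by (intro exI[of _ "q - (0, e / 2)"])
        (auto simp: W dist_norm left_diff_distrib norm_Pair mult_le_0_iff)
  qed
  ultimately show ?thesis by blast
qed

lemma bdry_in_frontier:
  assumes "\<sigma> = 1 \<or> \<sigma> = -1" "r \<ge> 0"
  shows "bdry \<sigma> r \<in> frontier (wedge (2 * \<alpha>))"
  using assms sin_pos cos_pos by (auto simp: frontier_wedge bdry_def tan_def abs_mult)

lemma frontier_bdryE:
  assumes "q \<in> frontier (wedge (2 * \<alpha>))" "q \<noteq> 0"
  obtains \<sigma> r where "\<sigma> = 1 \<or> \<sigma> = -1" "r > 0" "q = bdry \<sigma> r"
proof -
  obtain x y where q: "q = (x, y)" by (cases q)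
  have x: "\<bar>x\<bar> = y * (sin \<alpha> / cos \<alpha>)"
    using assms(1) by (simp add: frontier_wedge q tan_def)
  then have "y \<noteq> 0" "y * (sin \<alpha> / cos \<alpha>) \<ge> 0"
    using assms(2) by (auto simp: q zero_prod_def)
  then have "y > 0"
    using sin_pos cos_pos by (simp add: zero_le_mult_iff zero_le_divide_iff)
  then have "x \<noteq> 0"
    using x sin_pos cos_pos by auto
  show ?thesis
  proof (rule that)
    show "sgn x = 1 \<or> sgn x = -1" "y / cos \<alpha> > 0"
      using \<open>x \<noteq> 0\<close> \<open>y > 0\<close> cos_pos by (auto simp: sgn_if)
    show "q = bdry (sgn x) (y / cos \<alpha>)"
      using x cos_pos unfolding q bdry_def by (auto simp: sgn_if split: if_splits)
  qed
qed

lemma bdry_eq_iff: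
  assumes "\<sigma> = 1 \<or> \<sigma> = -1" "\<sigma>' = 1 \<or> \<sigma>' = -1" "r > 0" "r' > 0"
  shows "bdry \<sigma> r = bdry \<sigma>' r' \<longleftrightarrow> \<sigma> = \<sigma>' \<and> r = r'"
  using assms sin_pos cos_pos by (auto simp: bdry_def)

lemma bdry_nonzero: "r > 0 \<Longrightarrow> bdry \<sigma> r \<noteq> 0"
  using cos_pos by (auto simp: bdry_def zero_prod_def)

lemma inward_normal_bdry:
  assumes "\<sigma> = 1 \<or> \<sigma> = -1" "r > 0"
  shows "inward_normal (2 * \<alpha>) (bdry \<sigma> r) = side_normal \<sigma>"
  using assms sin_pos by (auto simp: inward_normal_def bdry_def side_normal_def sgn_mult)

lemma norm_bdry:
  assumes "\<sigma> = 1 \<or> \<sigma> = -1" "r > 0"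
  shows "norm (bdry \<sigma> r) = r"
proof -
  have "norm (bdry \<sigma> r) = sqrt (r\<^sup>2 * (sin \<alpha>)\<^sup>2 + r\<^sup>2 * (cos \<alpha>)\<^sup>2)"
    using assms(1) by (auto simp: bdry_def norm_Pair power_mult_distrib)
  then show ?thesis using assms(2) by (simp add: distrib_left[symmetric])
qed

lemma is_state_bdry:
  assumes "\<sigma> = 1 \<or> \<sigma> = -1" "r > 0"
  shows "is_state (2 * \<alpha>) (bdry \<sigma> r, v) \<longleftrightarrow> snd v \<bullet> side_normal \<sigma> > 0"
  using assms by (simp add: is_state_def bdry_in_frontier bdry_nonzero inward_normal_bdry)

lemma is_stateE:
  assumes "is_state (2 * \<alpha>) s"
  obtains \<sigma> r v where "\<sigma> = 1 \<or> \<sigma> = -1" "r > 0" "s = (bdry \<sigma> r, v)"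
    "snd v \<bullet> side_normal \<sigma> > 0"
proof -
  obtain q v where s: "s = (q, v)" by (cases s)
  have "q \<in> frontier (wedge (2 * \<alpha>))" "q \<noteq> 0"
    using assms by (auto simp: is_state_def s)
  then obtain \<sigma> r where "\<sigma> = 1 \<or> \<sigma> = -1" "r > 0" "q = bdry \<sigma> r"
    by (rule frontier_bdryE)
  then show ?thesis
    using that assms is_state_bdry unfolding s by blast
qed

section \<open>Flights between the two sides\<close>

lemma bdry_normal: "bdry \<sigma> r \<bullet> side_normal \<sigma> = 0" if "\<sigma> = 1 \<or> \<sigma> = -1"
  using that by (auto simp: bdry_def side_normal_def inner_prod_def)

text \<open>Signed distance to the line carrying the other side: the factor is the sine of the wedge
  angle \<open>2 * \<alpha>\<close>.\<close>

lemma bdry_normal_opposite: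
  "bdry \<sigma> r \<bullet> side_normal (- \<sigma>) = 2 * sin \<alpha> * cos \<alpha> * r" if "\<sigma> = 1 \<or> \<sigma> = -1"
  using that by (auto simp: bdry_def side_normal_def inner_prod_def)

text \<open>The relation \<open>r' * a' = r * a\<close> between the outgoing normal speeds is conservation of the
  angular momentum about the vertex along the flight, since a collision only reverses the
  normal speed.\<close>

lemma next_collisionE:
  assumes "next_collision (2 * \<alpha>) (bdry \<sigma> r, v) s'" "\<sigma> = 1 \<or> \<sigma> = -1" "r > 0"
  obtains r' where "r' > 0" "s' = (bdry (- \<sigma>) r', noslip_reflect (side_normal (- \<sigma>)) v)"
    "r' * (snd (snd s') \<bullet> side_normal (- \<sigma>)) = r * (snd v \<bullet> side_normal \<sigma>)"
proof -
  from assms(1) have st: "is_state (2 * \<alpha>) (bdry \<sigma> r, v)" "is_state (2 * \<alpha>) s'"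
    by (auto simp: next_collision_def)
  from st(2) obtain \<sigma>' r' v' where \<sigma>': "\<sigma>' = 1 \<or> \<sigma>' = -1" "r' > 0" and s': "s' = (bdry \<sigma>' r', v')"
    by (rule is_stateE)
  from assms(1) obtain t where t: "t > 0" "bdry \<sigma>' r' = bdry \<sigma> r + t *\<^sub>R snd v"
    and v': "v' = noslip_reflect (side_normal \<sigma>') v"
    using \<sigma>' by (auto simp: next_collision_def s' inward_normal_bdry)
  have a: "snd v \<bullet> side_normal \<sigma> > 0"
    using st(1) assms is_state_bdry by blast
  have E: "bdry \<sigma>' r' \<bullet> x = bdry \<sigma> r \<bullet> x + t * (snd v \<bullet> x)" for x
    by (simp add: t(2) inner_add_left)
  \<comment> \<open>A return to the same side would have zero displacement along its normal, but the
    normal speed there is positive.\<close>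
  have "\<sigma>' \<noteq> \<sigma>"
    using E[of "side_normal \<sigma>"] assms(2) a t(1) by (auto simp: bdry_normal)
  then have [simp]: "\<sigma>' = - \<sigma>"
    using \<sigma>'(1) assms(2) by auto
  \<comment> \<open>Projecting the flight on each of the two normals expresses both normal speeds
    through the same \<open>t\<close>; cross-multiplication gives the conserved product.\<close>
  have "t * (snd v \<bullet> side_normal \<sigma>) = 2 * sin \<alpha> * cos \<alpha> * r'"
    using E[of "side_normal \<sigma>"] bdry_normal_opposite[of "- \<sigma>" r'] assms(2)
    by (auto simp: bdry_normal)
  moreover have "t * (snd v' \<bullet> side_normal (- \<sigma>)) = 2 * sin \<alpha> * cos \<alpha> * r"
    using E[of "side_normal (- \<sigma>)"] bdry_normal[of "- \<sigma>" r'] assms(2) normal_reflect[of "- \<sigma>" v]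
    by (auto simp: bdry_normal_opposite v')
  ultimately have "t * (r' * (snd v' \<bullet> side_normal (- \<sigma>))) = t * (r * (snd v \<bullet> side_normal \<sigma>))"
    by (metis mult.assoc mult.commute)
  then show ?thesis
    using that[of r'] \<sigma>'(2) t(1) by (simp add: s' v')
qed

text \<open>Converse to the previous lemma: \<open>a\<close> is the speed of leaving the current
  side and \<open>b\<close> the speed of approaching the other. Positivity of both guarantees a
  collision away from the vertex.\<close>

lemma next_collision_bdry:
  assumes \<sigma>: "\<sigma> = 1 \<or> \<sigma> = -1" and r: "r > 0"
    and a: "snd v \<bullet> side_normal \<sigma> = a" "a > 0"
    and b: "snd v \<bullet> side_normal (- \<sigma>) = - b" "b > 0"
  shows "next_collision (2 * \<alpha>) (bdry \<sigma> r, v)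
    (bdry (- \<sigma>) (r * a / b), noslip_reflect (side_normal (- \<sigma>)) v)"
proof -
  \<comment> \<open>The flight time is the distance to the opposite side divided by the approach
    speed, and the new distance to the vertex is forced by conservation of the product.\<close>
  let ?r = "r * a / b" and ?t = "2 * sin \<alpha> * cos \<alpha> * r / b"
  have r': "?r > 0" and \<sigma>': "- \<sigma> = 1 \<or> - \<sigma> = -1"
    using assms by auto
  obtain w1 w2 where w: "snd v = (w1, w2)" by (cases "snd v")
  have t: "?t > 0"
    using sin_pos cos_pos r b by simp
  have "bdry (- \<sigma>) ?r = bdry \<sigma> r + ?t *\<^sub>R snd v"
  proof -
    have "a = - \<sigma> * cos \<alpha> * w1 + sin \<alpha> * w2" "b = - \<sigma> * cos \<alpha> * w1 - sin \<alpha> * w2"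
      using a b by (auto simp: w side_normal_def inner_prod_def algebra_simps)
    then have w12: "w1 = - \<sigma> * (a + b) / (2 * cos \<alpha>)" "w2 = (a - b) / (2 * sin \<alpha>)"
      using \<sigma> sin_pos cos_pos by auto
    then show ?thesis
      unfolding bdry_def w w12 using b(2) sin_pos cos_pos by (auto simp: field_simps)
  qed
  moreover have "bdry \<sigma> r + x *\<^sub>R snd v \<notin> frontier (wedge (2 * \<alpha>))" if x: "0 < x" "x < ?t" for x
  proof
    let ?q = "bdry \<sigma> r + x *\<^sub>R snd v"
    assume q: "?q \<in> frontier (wedge (2 * \<alpha>))"
    \<comment> \<open>During the flight both normal coordinates are positive, while every boundary
      point has one that vanishes.\<close>
    have 1: "?q \<bullet> side_normal \<sigma> > 0"
      using x a \<sigma> by (simp add: inner_add_left bdry_normal)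
    have 2: "?q \<bullet> side_normal (- \<sigma>) > 0"
      using x b \<sigma> by (simp add: inner_add_left bdry_normal_opposite field_simps)
    have "?q \<noteq> 0"
      using 1 by auto
    from q this obtain \<rho> y where "\<rho> = 1 \<or> \<rho> = -1" "?q = bdry \<rho> y"
      by (rule frontier_bdryE)
    then show False
      using 1 2 bdry_normal[of \<rho> y] \<sigma> by auto
  qed
  moreover have "is_state (2 * \<alpha>) (bdry \<sigma> r, v)"
    using is_state_bdry[OF \<sigma> r] a by simp
  moreover have "is_state (2 * \<alpha>) (bdry (- \<sigma>) ?r, noslip_reflect (side_normal (- \<sigma>)) v)"
    unfolding is_state_bdry[OF \<sigma>' r'] normal_reflect[OF \<sigma>'] using b by simp
  ultimately show ?thesis
    unfolding next_collision_def fst_conv snd_conv inward_normal_bdry[OF \<sigma>' r'] using t by blast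
qed

section \<open>Iterated collisions and recurrence\<close>

lemma infinite_orbit_step:
  assumes "infinite_orbit (2 * \<alpha>) s" "\<sigma> = 1 \<or> \<sigma> = -1" "r > 0" "s k = (bdry \<sigma> r, v)"
  obtains r' where "r' > 0" "s (Suc k) = (bdry (- \<sigma>) r', noslip_reflect (side_normal (- \<sigma>)) v)"
    "r' * (snd (snd (s (Suc k))) \<bullet> side_normal (- \<sigma>)) = r * (snd v \<bullet> side_normal \<sigma>)"
  using assms next_collisionE unfolding infinite_orbit_def by metis

text \<open>Two collisions reflect the transverse part in the lines at angles
  \<open>- \<sigma> * \<phi> / 2\<close> and \<open>\<sigma> * \<phi> / 2\<close>, which compose to
  the rotation by \<open>2 * \<sigma> * \<phi>\<close>; the two sign changes of the axial part
  cancel.\<close>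

lemma infinite_orbit_double_steps:
  assumes orb: "infinite_orbit (2 * \<alpha>) s"
    and \<sigma>: "\<sigma> = 1 \<or> \<sigma> = -1" and r: "r > 0" and sk: "s k = (bdry \<sigma> r, v)"
  shows "\<exists>r' v'. r' > 0 \<and> s (k + 2 * m) = (bdry \<sigma> r', v') \<and>
    r' * (snd v' \<bullet> side_normal \<sigma>) = r * (snd v \<bullet> side_normal \<sigma>) \<and>
    axial v' = axial v \<and> transverse v' = cis (2 * \<sigma> * real m * \<phi>) * transverse v"
proof (induction m)
  case 0
  then show ?case using r sk by auto
next
  case (Suc m)
  then obtain r' v' where r': "r' > 0" and s': "s (k + 2 * m) = (bdry \<sigma> r', v')"
    and a: "r' * (snd v' \<bullet> side_normal \<sigma>) = r * (snd v \<bullet> side_normal \<sigma>)"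
    and c: "axial v' = axial v" "transverse v' = cis (2 * \<sigma> * real m * \<phi>) * transverse v"
    by blast
  from infinite_orbit_step[OF orb \<sigma> r' s'] obtain r1 v1 where r1: "r1 > 0"
    and s1: "s (Suc (k + 2 * m)) = (bdry (- \<sigma>) r1, v1)"
    and v1: "v1 = noslip_reflect (side_normal (- \<sigma>)) v'"
    and a1: "r1 * (snd v1 \<bullet> side_normal (- \<sigma>)) = r' * (snd v' \<bullet> side_normal \<sigma>)"
    by (metis snd_conv)
  have \<sigma>': "- \<sigma> = 1 \<or> - \<sigma> = -1" using \<sigma> by auto
  from infinite_orbit_step[OF orb \<sigma>' r1 s1] obtain r2 v2 where r2: "r2 > 0"
    and s2: "s (Suc (Suc (k + 2 * m))) = (bdry \<sigma> r2, v2)"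
    and v2: "v2 = noslip_reflect (side_normal \<sigma>) v1"
    and a2: "r2 * (snd v2 \<bullet> side_normal \<sigma>) = r1 * (snd v1 \<bullet> side_normal (- \<sigma>))"
    by (metis snd_conv minus_minus)
  have "transverse v2 = cis (\<sigma> * \<phi> + \<sigma> * \<phi> + 2 * \<sigma> * real m * \<phi>) * transverse v"
    by (simp add: v2 v1 transverse_reflect[OF \<sigma>] transverse_reflect[OF \<sigma>'] c cis_cnj
        cis_mult mult.assoc[symmetric])
  moreover have "\<sigma> * \<phi> + \<sigma> * \<phi> + 2 * \<sigma> * real m * \<phi> = 2 * \<sigma> * real (Suc m) * \<phi>"
    by (simp add: algebra_simps)
  ultimately show ?case
    using r2 s2 a a1 a2 c by (auto simp: v1 v2 axial_reflect[OF \<sigma>] axial_reflect[OF \<sigma>'])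
qed

text \<open>After \<open>n\<close> pairs of collisions the transverse part has made one full turn,
  so the velocity is restored on the same side.\<close>

lemma infinite_orbit_recurs:
  assumes orb: "infinite_orbit (2 * \<alpha>) s" and n: "real n * \<phi> = pi"
  shows "recurs_after (2 * n) s"
  unfolding recurs_after_def
proof
  fix k
  have "is_state (2 * \<alpha>) (s k)"
    using orb by (auto simp: infinite_orbit_def next_collision_def)
  then obtain \<sigma> r v where \<sigma>: "\<sigma> = 1 \<or> \<sigma> = -1" and r: "r > 0" and sk: "s k = (bdry \<sigma> r, v)"
    and a: "snd v \<bullet> side_normal \<sigma> > 0"
    by (rule is_stateE)
  from infinite_orbit_double_steps[OF orb \<sigma> r sk, of n] obtain r' v'
    where s': "s (k + 2 * n) = (bdry \<sigma> r', v')"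
      and a': "r' * (snd v' \<bullet> side_normal \<sigma>) = r * (snd v \<bullet> side_normal \<sigma>)"
      and c: "axial v' = axial v" "transverse v' = cis (2 * \<sigma> * real n * \<phi>) * transverse v"
    by blast
  have "cis (2 * \<sigma> * real n * \<phi>) = cis (\<sigma> * (2 * pi))"
    using n by (simp add: mult.assoc mult.left_commute)
  also have "\<dots> = 1"
    using \<sigma> by (auto simp: complex_eq_iff)
  finally have "v' = v"
    using c by (intro velocity_eqI) auto
  \<comment> \<open>With equal velocities the positive normal speed cancels from the conserved
    product, so the distances to the vertex agree.\<close>
  then show "s (k + 2 * n) = s k"
    using a a' s' sk by auto
qed

section \<open>A bounded orbit without early recurrence\<close>

text \<open>Chosen large enough to keep all normal speeds positive beside a unit transverse part: 3
  exceeds the bound 2 on the real part's contribution, and the second summand offsets a loss of at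
  most \<open>sin \<alpha>\<close> from the imaginary part.\<close>

definition witness_axial :: real where
  "witness_axial = 3 + axis_norm * sin \<alpha> / cos \<alpha>"

text \<open>Closed form of the velocities that start on the right side with transverse part 1 and
  collide alternately with the left and right sides.\<close>

definition witness_velocity :: "nat \<Rightarrow> velocity" where
  "witness_velocity k = vel ((-1) ^ k * witness_axial) (cis ((-1) ^ k * (real k * \<phi>)))"

definition witness_speed :: "nat \<Rightarrow> real" where
  "witness_speed k = snd (witness_velocity k) \<bullet> side_normal ((-1) ^ k)"

text \<open>The distance normalizes the conserved product to 1.\<close>

definition witness :: "nat \<Rightarrow> state" where
  "witness k = (bdry ((-1) ^ k) (1 / witness_speed k), witness_velocity k)"

lemma sign_power: "(-1) ^ k = (1::real) \<or> (-1) ^ k = (-1::real)"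
  by (cases "even k") auto

lemma witness_velocity_Suc:
  "witness_velocity (Suc k) = noslip_reflect (side_normal ((-1) ^ Suc k)) (witness_velocity k)"
proof (rule velocity_eqI)
  show "axial (witness_velocity (Suc k)) =
    axial (noslip_reflect (side_normal ((-1) ^ Suc k)) (witness_velocity k))"
    using axial_reflect[OF sign_power[of "Suc k"]] by (simp add: witness_velocity_def)
  show "transverse (witness_velocity (Suc k)) =
    transverse (noslip_reflect (side_normal ((-1) ^ Suc k)) (witness_velocity k))"
    unfolding transverse_reflect[OF sign_power]
    by (simp add: witness_velocity_def cis_cnj cis_mult algebra_simps)
qed

text \<open>Positivity makes every flight reach the other side, and uniformity in \<open>k\<close>
  bounds the distances \<open>1 / witness_speed k\<close>.\<close>

lemma witness_speed_lower: "witness_speed k \<ge> cos \<alpha> / axis_norm"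
proof -
  define \<sigma> :: real where "\<sigma> = (-1) ^ k"
  have \<sigma>: "\<sigma> = 1 \<or> \<sigma> = -1"
    unfolding \<sigma>_def by (rule sign_power)
  define z where "z = cis (\<sigma> * (real k * \<phi>))"
  have z: "\<bar>Re z\<bar> \<le> 1" "\<bar>Im z\<bar> \<le> 1"
    by (simp_all add: z_def)
  have "witness_velocity k = vel (\<sigma> * witness_axial) z"
    by (simp add: witness_velocity_def \<sigma>_def z_def)
  then have "witness_speed k = cos \<alpha> / axis_norm * (witness_axial - \<sigma> * (sqrt 2 * (sin \<alpha> * Re z)))
      + sin \<alpha> * Im z"
    using \<sigma> axis_norm_pos
    by (auto simp: witness_speed_def \<sigma>_def[symmetric] vel_def side_normal_def inner_prod_def
        field_simps)
  moreover have "sin \<alpha> * Im z \<ge> - sin \<alpha>"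
    using mult_left_mono[of "-1" "Im z" "sin \<alpha>"] z sin_pos by auto
  moreover have "sqrt 2 * (sin \<alpha> * \<bar>Re z\<bar>) \<le> 2 * (1 * 1)"
    using z sin_pos sqrt2_less_2 by (intro mult_mono) auto
  then have "\<bar>\<sigma> * (sqrt 2 * (sin \<alpha> * Re z))\<bar> \<le> 2"
    using \<sigma> sin_pos by (auto simp: abs_mult)
  then have "cos \<alpha> / axis_norm * (witness_axial - \<sigma> * (sqrt 2 * (sin \<alpha> * Re z)))
      \<ge> cos \<alpha> / axis_norm * (1 + axis_norm * sin \<alpha> / cos \<alpha>)"
    using cos_pos axis_norm_pos by (intro mult_left_mono) (auto simp: witness_axial_def)
  moreover have "cos \<alpha> / axis_norm * (1 + axis_norm * sin \<alpha> / cos \<alpha>) = cos \<alpha> / axis_norm + sin \<alpha>"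
    using cos_pos axis_norm_pos by (simp add: field_simps)
  ultimately show ?thesis by linarith
qed

lemma witness_speed_pos: "witness_speed k > 0"
  using witness_speed_lower[of k] cos_pos axis_norm_pos
  by (meson divide_pos_pos less_le_trans)

lemma infinite_orbit_witness: "infinite_orbit (2 * \<alpha>) witness"
  unfolding infinite_orbit_def
proof
  fix k
  \<comment> \<open>The approach speed of one flight is the normal speed after the next collision,
    so the distance becomes \<open>1 / witness_speed (Suc k)\<close>.\<close>
  have "snd (witness_velocity k) \<bullet> side_normal ((-1) ^ Suc k) = - witness_speed (Suc k)"
    unfolding witness_speed_def witness_velocity_Suc normal_reflect[OF sign_power] by simp
  then show "next_collision (2 * \<alpha>) (witness k) (witness (Suc k))"
    using next_collision_bdry[OF sign_power, of "1 / witness_speed k" "witness_velocity k" k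
        "witness_speed k" "witness_speed (Suc k)"] witness_speed_pos[of k] witness_speed_pos[of "Suc k"]
      witness_velocity_Suc[of k]
    by (simp add: witness_def witness_speed_def[symmetric])
qed

lemma bounded_orbit_witness: "bounded_orbit (2 * \<alpha>) witness"
proof -
  let ?B = "cball (0 :: plane) (axis_norm / cos \<alpha>)"
  have "fst (witness k) \<in> ?B" for k
  proof -
    have "1 / witness_speed k \<le> 1 / (cos \<alpha> / axis_norm)"
      using witness_speed_lower[of k] witness_speed_pos[of k] cos_pos axis_norm_pos
      by (intro divide_left_mono mult_pos_pos divide_pos_pos) auto
    then show ?thesis
      using norm_bdry[OF sign_power, of "1 / witness_speed k" k] witness_speed_pos[of k]
      by (simp add: witness_def)
  qed
  then have "(\<Union>k. closed_segment (fst (witness k)) (fst (witness (Suc k)))) \<subseteq> ?B"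
    by (intro UN_least closed_segment_subset) auto
  then show ?thesis
    using infinite_orbit_witness bounded_subset[OF bounded_cball] by (auto simp: bounded_orbit_def)
qed

text \<open>Recurrence on the starting side makes \<open>(-1) ^ p\<close> equal to 1, and recurrence
  of the transverse part then gives \<open>cis (real p * \<phi>) = 1\<close>. Thus
  \<open>real p * \<phi>\<close> is a positive multiple of \<open>2 * pi\<close>.\<close>

lemma witness_not_recurs_early:
  assumes "recurs_after p witness" "p \<ge> 1"
  shows "real p * \<phi> \<ge> 2 * pi"
proof (rule ccontr)
  assume less: "\<not> real p * \<phi> \<ge> 2 * pi"
  have w: "witness p = witness 0"
    using assms(1) by (metis recurs_after_def add_0)
  then have "(-1) ^ p = (1::real)"
    using bdry_eq_iff[OF sign_power[of p] sign_power[of 0]] witness_speed_pos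
    by (simp add: witness_def)
  moreover from w have "transverse (witness_velocity p) = transverse (witness_velocity 0)"
    by (simp add: witness_def)
  ultimately have "cis (real p * \<phi>) = 1"
    by (simp add: witness_velocity_def)
  then have "cos (real p * \<phi>) = 1"
    by (simp add: complex_eq_iff)
  then obtain j :: int where j: "real p * \<phi> = j * 2 * pi"
    by (auto simp: cos_one_2pi_int)
  have "real p * \<phi> > 0"
    using assms(2) \<phi>_pos by simp
  with j less have "0 < j" "j < 1"
    by (auto simp: zero_less_mult_iff)
  then show False by simp
qed

end

section \<open>Minimal periods, choice of the angle, and conclusion\<close>

lemma orbit_period_le:
  assumes "recurs_after p s" "p \<ge> 1"
  shows "orbit_period s \<le> p"
  unfolding orbit_period_def using assms by (intro Least_le) auto

lemma recurs_after_orbit_period: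
  assumes "periodic_orbit s"
  shows "orbit_period s \<ge> 1" "recurs_after (orbit_period s) s"
  using assms LeastI_ex[of "\<lambda>p. p \<ge> 1 \<and> recurs_after p s"]
  by (auto simp: periodic_orbit_def orbit_period_def)

text \<open>For \<open>n \<ge> 2\<close> the half-angle \<open>pi / (2 * n)\<close> is at most
  \<open>pi / 4\<close>, so the required cosine is positive and at most \<open>sqrt 3 / 2\<close>,
  and \<open>arccos\<close> gives an admissible \<open>\<alpha>\<close>.\<close>

lemma noslip_wedge_exists:
  assumes "n \<ge> 2"
  shows "\<exists>\<alpha>. noslip_wedge \<alpha> (pi / real n)"
proof -
  let ?h = "pi / real n / 2" and ?c = "sqrt (3/2) * sin (pi / real n / 2)"
  have h: "0 < ?h" "?h \<le> pi / 4"
    using assms by (auto simp: field_simps)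
  have "sin ?h > 0"
    using h by (intro sin_gt_zero) auto
  have "sin ?h \<le> sin (pi / 4)"
    using h by (intro sin_monotone_2pi_le) auto
  then have "?c \<le> sqrt (3/2) * (sqrt 2 / 2)"
    by (intro mult_left_mono) (auto simp: sin_45)
  also have "\<dots> = sqrt 3 / 2"
    by (simp add: real_sqrt_divide)
  also have "\<dots> < 1"
    using real_sqrt_less_mono[of 3 4] by simp
  finally have c: "?c < 1" "?c > 0"
    using \<open>sin ?h > 0\<close> by auto
  show ?thesis
  proof (intro exI[of _ "arccos ?c"] noslip_wedge.intro)
    show "0 < arccos ?c" "arccos ?c < pi / 2"
      using c arccos_less_arccos[of ?c 1] arccos_less_arccos[of 0 ?c] by auto
    show "0 < pi / real n" "pi / real n < pi"
      using assms by (auto simp: field_simps)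
    show "cos (arccos ?c) = ?c"
      using c by (intro cos_arccos) auto
  qed
qed

theorem corollary2p1:
  fixes n :: nat
  assumes "n \<ge> 2"
  shows "\<exists>\<theta>. 0 < \<theta> \<and> \<theta> < pi \<and>
    (\<exists>s. nondegenerate_bounded_orbit n \<theta> s) \<and>
    (\<forall>s. nondegenerate_bounded_orbit n \<theta> s \<longrightarrow> periodic_orbit s \<and> orbit_period s = 2 * n)"
proof -
  obtain \<alpha> where "noslip_wedge \<alpha> (pi / real n)"
    using noslip_wedge_exists[OF assms] by blast
  then interpret noslip_wedge \<alpha> "pi / real n" .
  \<comment> \<open>This makes the witness nondegenerate and provides the existence claim.\<close>
  have "\<not> orbit_period witness < 2 * n" if "periodic_orbit witness"
  proof -
    have "real (orbit_period witness) * (pi / real n) \<ge> 2 * pi"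
      using witness_not_recurs_early recurs_after_orbit_period[OF that] by blast
    then have "pi * real (orbit_period witness) \<ge> pi * real (2 * n)"
      using assms by (simp add: field_simps)
    then show ?thesis
      by (simp add: mult_le_cancel_left_pos)
  qed
  then have "nondegenerate_bounded_orbit n (2 * \<alpha>) witness"
    using bounded_orbit_witness by (auto simp: nondegenerate_bounded_orbit_def)
  moreover have "periodic_orbit s \<and> orbit_period s = 2 * n"
    if s: "nondegenerate_bounded_orbit n (2 * \<alpha>) s" for s
  proof -
    \<comment> \<open>Recurrence bounds the period above by \<open>2 * n\<close>; nondegeneracy
      supplies the lower bound.\<close>
    have "recurs_after (2 * n) s"
      using s assms by (intro infinite_orbit_recurs)
        (auto simp: nondegenerate_bounded_orbit_def bounded_orbit_def)
    moreover have "1 \<le> 2 * n"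
      using assms by simp
    ultimately have "periodic_orbit s" "orbit_period s \<le> 2 * n"
      using orbit_period_le unfolding periodic_orbit_def by blast+
    then show ?thesis
      using s by (auto simp: nondegenerate_bounded_orbit_def)
  qed
  ultimately show ?thesis
    using \<alpha>_pos \<alpha>_less by (intro exI[of _ "2 * \<alpha>"]) auto
qed

end
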